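(* Let $\alpha\in\mathbb{R}$ and let $(\rho,u)$ be a classical solution of the coupled Burgers system $$\partial_t\rho+\partial_x(\rho u)=0,\qquad \partial_tu+\partial_x\Big(\frac{u^2+\alpha\rho^2}{2}\Big)=0,\qquad x\in\mathbb{R},\ t>0.$$ Then the quantities $$\lambda_1\int_{\mathbb{R}}(u+\sqrt\alpha\,\rho)^{k_1}\,dx+\lambda_2\int_{\mathbb{R}}(u-\sqrt\alpha\,\rho)^{k_2}\,dx$$ are conserved for any constants $\lambda_1,\lambda_2\in\mathbb{C}$ and any positive integers $k_1,k_2$.
   Context: $\rho,u$ are real-valued functions of $(x,t)$. For $\alpha<0$ the convention is $\sqrt\alpha=i\sqrt{|\alpha|}$. "Conserved" means independent of $t$.
   Formalization: Conditions at spatial infinity are added, since the integrals are otherwise undefined (e.g. u=1, ρ=0): ρ and u are bounded on R×[a,b] for all 0<a≤b, and each integral with nonzero coefficient converges absolutely at every t>0. *)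

theory Defs
  imports "HOL-Analysis.Analysis"
begin

text \<open>Functions of position and time are curried, position first: \<open>f x t\<close>.\<close>

definition dx :: "(real \<Rightarrow> real \<Rightarrow> real) \<Rightarrow> real \<Rightarrow> real \<Rightarrow> real" where
  "dx f x t = deriv (\<lambda>y. f y t) x"

definition dt :: "(real \<Rightarrow> real \<Rightarrow> real) \<Rightarrow> real \<Rightarrow> real \<Rightarrow> real" where
  "dt f x t = deriv (\<lambda>s. f x s) t"

text \<open>Class \<open>C\<^sup>1\<close> on the open half plane \<open>t > 0\<close>. The library function \<open>deriv\<close> is total,
  so existence of the partial derivatives is required separately.\<close>

definition C1_half_plane :: "(real \<Rightarrow> real \<Rightarrow> real) \<Rightarrow> bool" where
  "C1_half_plane f \<longleftrightarrow>
     (\<forall>x. \<forall>t>0. (\<lambda>y. f y t) field_differentiable at x \<and> (\<lambda>s. f x s) field_differentiable at t) \<and>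
     continuous_on (UNIV \<times> {0<..}) (\<lambda>(x, t). f x t) \<and>
     continuous_on (UNIV \<times> {0<..}) (\<lambda>(x, t). dx f x t) \<and>
     continuous_on (UNIV \<times> {0<..}) (\<lambda>(x, t). dt f x t)"

definition classical_solution ::
    "real \<Rightarrow> (real \<Rightarrow> real \<Rightarrow> real) \<Rightarrow> (real \<Rightarrow> real \<Rightarrow> real) \<Rightarrow> bool" where
  "classical_solution \<alpha> \<rho> u \<longleftrightarrow>
     C1_half_plane \<rho> \<and> C1_half_plane u \<and>
     (\<forall>x. \<forall>t>0.
        dt \<rho> x t + dx (\<lambda>y s. \<rho> y s * u y s) x t = 0 \<and>
        dt u x t + dx (\<lambda>y s. ((u y s)\<^sup>2 + \<alpha> * (\<rho> y s)\<^sup>2) / 2) x t = 0)"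

text \<open>The square root of a real \<open>\<alpha>\<close> of either sign is \<open>csqrt (of_real \<alpha>)\<close>: the principal
  branch gives \<open>\<i> * sqrt \<bar>\<alpha>\<bar>\<close> for \<open>\<alpha> < 0\<close>.\<close>

definition w_plus :: "real \<Rightarrow> (real \<Rightarrow> real \<Rightarrow> real) \<Rightarrow> (real \<Rightarrow> real \<Rightarrow> real) \<Rightarrow> real \<Rightarrow> real \<Rightarrow> complex" where
  "w_plus \<alpha> \<rho> u x t = of_real (u x t) + csqrt (of_real \<alpha>) * of_real (\<rho> x t)"

definition w_minus :: "real \<Rightarrow> (real \<Rightarrow> real \<Rightarrow> real) \<Rightarrow> (real \<Rightarrow> real \<Rightarrow> real) \<Rightarrow> real \<Rightarrow> real \<Rightarrow> complex" where
  "w_minus \<alpha> \<rho> u x t = of_real (u x t) - csqrt (of_real \<alpha>) * of_real (\<rho> x t)"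

end

theory Submission
  imports Defs
begin

text \<open>With \<open>c\<^sup>2 = \<alpha>\<close>, the function \<open>w = u + c \<rho>\<close> solves the Burgers equation
  \<open>w\<^sub>t + w w\<^sub>x = 0\<close>, so that \<open>w^k\<close> is a conserved density with flux \<open>k / (k + 1) w^(k + 1)\<close>.
  The integral of \<open>w^k\<close> over the line is therefore constant as soon as the flux through \<open>x = \<plusminus>R\<close>,
  integrated in time, vanishes for large \<open>R\<close>. Integrability of \<open>w^k\<close> at each time separately does
  not give this: no bound uniform in time is assumed, and for \<open>\<alpha> < 0\<close>, where \<open>w\<close> is not real, the
  equation for \<open>w\<close> gives no conservation law for \<open>\<bar>w\<bar>^k\<close> that would provide one.

  A cutoff that is compatible with the equation avoids the difficulty. Since \<open>w\<close> and \<open>x - t w\<close> are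
  both annihilated by \<open>\<partial>\<^sub>t + w \<partial>\<^sub>x\<close>, for every holomorphic \<open>g\<close> the pair
    \<open>D = \<integral> k v^(k - 1) g(x - t v) dv\<close>,  \<open>E = \<integral> k v^k g(x - t v) dv\<close>,
  both integrals over \<open>v\<close> from \<open>0\<close> to \<open>w\<close>, satisfies \<open>D\<^sub>t + E\<^sub>x = 0\<close>.
  Take \<open>g(\<zeta>) = (\<i>L / (\<zeta> + \<i>L))^(k + 2)\<close>, which tends to \<open>1\<close> as \<open>L\<close> grows; with \<open>z = x + \<i>L\<close> and \<open>y = w / (z - t w)\<close> both integrals are then explicit:
    \<open>D = (\<i>L)^(k + 2) / z\<^sup>2 (y^k + k / (k + 1) t y^(k + 1))\<close>,
    \<open>E = (\<i>L)^(k + 2) k / (k + 1) y^(k + 1) / z\<close>.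
  As \<open>w\<close> is bounded on time slabs, the poles stay away once \<open>L\<close> is large
  (\<open>denominator_ge\<close>). For fixed \<open>L\<close> the flux \<open>E\<close> is \<open>O(1 / \<bar>x\<bar>)\<close> uniformly in time
  (\<open>reg_flux_decay\<close>), so the integral of \<open>D\<close> is conserved (\<open>line_balance\<close>). Moreover
  \<open>\<bar>D\<bar> \<le> 2^(k + 1) \<bar>w\<bar>^k\<close> uniformly in \<open>L\<close> (\<open>reg_density_bound\<close>) and \<open>D \<rightarrow> w^k\<close> pointwise as
  \<open>L \<rightarrow> \<infinity>\<close> (\<open>reg_density_tendsto\<close>). Dominated convergence, at each of two times, transfers the
  conservation to \<open>w^k\<close> (\<open>power_integral_conserved\<close>). Only integrability of \<open>w^k\<close> at those two
  times enters.\<close>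

section \<open>Balance laws in one space dimension\<close>

lemma integral_of_flux_derivative:
  fixes E f :: "real \<Rightarrow> real \<Rightarrow> 'a :: banach"
  assumes "l \<le> r"
    and "\<And>x. ((\<lambda>y. E y t) has_vector_derivative - f x t) (at x)"
  shows "integral {l..r} (\<lambda>x. f x t) = E l t - E r t"
proof -
  have "((\<lambda>y. - E y t) has_vector_derivative f x t) (at x)" for x
    using has_vector_derivative_minus[OF assms(2)] by simp
  then have "((\<lambda>x. f x t) has_integral (- E r t - - E l t)) {l..r}"
    using \<open>l \<le> r\<close>
    by (intro fundamental_theorem_of_calculus) (auto intro: has_vector_derivative_at_within)
  then show ?thesis by (simp add: integral_unique)
qed

lemma rectangle_balance:
  fixes D E f :: "real \<Rightarrow> real \<Rightarrow> 'a :: banach"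
  assumes "a \<le> b" "l \<le> r"
    and Dt: "\<And>x t. t \<in> {a..b} \<Longrightarrow> ((\<lambda>s. D x s) has_vector_derivative f x t) (at t)"
    and Ex: "\<And>x t. t \<in> {a..b} \<Longrightarrow> ((\<lambda>y. E y t) has_vector_derivative - f x t) (at x)"
    and cont: "continuous_on (UNIV \<times> {a..b}) (\<lambda>(x, t). f x t)"
  shows "integral {l..r} (\<lambda>x. D x b - D x a) = integral {a..b} (\<lambda>t. E l t - E r t)"
proof -
  have t_int: "integral {a..b} (\<lambda>t. f x t) = D x b - D x a" for x
    using \<open>a \<le> b\<close> Dt
    by (intro integral_unique fundamental_theorem_of_calculus) (auto intro: has_vector_derivative_at_within)
  have "continuous_on (cbox (l, a) (r, b)) (\<lambda>(x, t). f x t)"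
    by (rule continuous_on_subset[OF cont]) (auto simp: cbox_Pair_eq)
  from integral_swap_continuous[OF this]
  have "integral {l..r} (\<lambda>x. integral {a..b} (f x)) = integral {a..b} (\<lambda>t. integral {l..r} (\<lambda>x. f x t))"
    by (simp add: cbox_interval)
  also have "\<dots> = integral {a..b} (\<lambda>t. E l t - E r t)"
    by (intro integral_cong integral_of_flux_derivative \<open>l \<le> r\<close> Ex)
  finally show ?thesis by (simp add: t_int)
qed

lemma tendsto_integral_symmetric_interval:
  fixes g :: "real \<Rightarrow> 'a :: euclidean_space"
  assumes "integrable lborel g"
  shows "(\<lambda>n. integral {- real n..real n} g) \<longlonglongrightarrow> (\<integral>x. g x \<partial>lborel)"
proof -
  have "(\<lambda>n. \<integral>x. indicator {- real n..real n} x *\<^sub>R g x \<partial>lborel) \<longlonglongrightarrow> (\<integral>x. g x \<partial>lborel)"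
  proof (rule integral_dominated_convergence[where w = "\<lambda>x. norm (g x)"])
    show "AE x in lborel. (\<lambda>n. indicator {- real n..real n} x *\<^sub>R g x) \<longlonglongrightarrow> g x"
    proof (rule AE_I2)
      fix x
      obtain N where N: "\<bar>x\<bar> \<le> real N" using real_arch_simple by blast
      have "\<forall>\<^sub>F n in sequentially. indicator {- real n..real n} x *\<^sub>R g x = g x"
        using eventually_ge_at_top[of N]
      proof eventually_elim
        case (elim n)
        then have "\<bar>x\<bar> \<le> real n" using N by linarith
        then show ?case by (simp add: abs_le_iff)
      qed
      then show "(\<lambda>n. indicator {- real n..real n} x *\<^sub>R g x) \<longlonglongrightarrow> g x"
        by (rule tendsto_eventually)
    qed
  qed (use assms in \<open>auto simp: indicator_def\<close>)
  moreover have "set_integrable lborel {- real n..real n} g" for n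
    unfolding set_integrable_def using assms by (intro integrable_mult_indicator) auto
  then have "(\<integral>x. indicator {- real n..real n} x *\<^sub>R g x \<partial>lborel) = integral {- real n..real n} g" for n
    using set_borel_integral_eq_integral(2) by (metis set_lebesgue_integral_def)
  ultimately show ?thesis by simp
qed

text \<open>The decay of the flux \<open>E\<close> makes its contribution through \<open>x = \<plusminus>n\<close> tend to zero.\<close>

lemma line_balance:
  fixes D E f :: "real \<Rightarrow> real \<Rightarrow> 'a :: euclidean_space"
  assumes "a \<le> b"
    and Dt: "\<And>x t. t \<in> {a..b} \<Longrightarrow> ((\<lambda>s. D x s) has_vector_derivative f x t) (at t)"
    and Ex: "\<And>x t. t \<in> {a..b} \<Longrightarrow> ((\<lambda>y. E y t) has_vector_derivative - f x t) (at x)"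
    and cont: "continuous_on (UNIV \<times> {a..b}) (\<lambda>(x, t). f x t)"
    and decay: "\<And>x t. t \<in> {a..b} \<Longrightarrow> \<bar>x\<bar> * norm (E x t) \<le> C"
    and int: "integrable lborel (\<lambda>x. D x a)" "integrable lborel (\<lambda>x. D x b)"
  shows "(\<integral>x. D x b \<partial>lborel) = (\<integral>x. D x a \<partial>lborel)"
proof -
  define J where "J n = integral {- real n..real n} (\<lambda>x. D x b - D x a)" for n
  have "J \<longlonglongrightarrow> (\<integral>x. D x b - D x a \<partial>lborel)"
    unfolding J_def using int by (intro tendsto_integral_symmetric_interval) auto
  moreover have "J \<longlonglongrightarrow> 0"
  proof (rule Lim_null_comparison)
    show "(\<lambda>n. 2 * C * (b - a) / real n) \<longlonglongrightarrow> 0"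
      by (rule lim_const_over_n)
    show "\<forall>\<^sub>F n in sequentially. norm (J n) \<le> 2 * C * (b - a) / real n"
      using eventually_gt_at_top[of 0]
    proof eventually_elim
      case (elim n)
      have "continuous_on {a..b} (\<lambda>t. integral {- real n..real n} (\<lambda>x. f x t))"
      proof -
        have "continuous_on ({a..b} \<times> cbox (- real n) (real n)) (\<lambda>p. case prod.swap p of (x, t) \<Rightarrow> f x t)"
          by (rule continuous_on_compose2[OF cont continuous_on_swap]) auto
        then have "continuous_on ({a..b} \<times> cbox (- real n) (real n)) (\<lambda>(t, x). f x t)"
          by (simp add: case_prod_beta)
        from integral_continuous_on_param[OF this] show ?thesis
          by (simp add: cbox_interval)
      qed
      moreover have "integral {- real n..real n} (\<lambda>x. f x t) = E (- real n) t - E (real n) t"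
        if "t \<in> {a..b}" for t
        by (intro integral_of_flux_derivative Ex that) simp
      ultimately have int_E: "(\<lambda>t. E (- real n) t - E (real n) t) integrable_on {a..b}"
        by (intro integrable_continuous_real) (rule continuous_on_eq)
      have E_le: "norm (E x t) \<le> C / real n" if "t \<in> {a..b}" "\<bar>x\<bar> = real n" for x t
        using decay[OF that(1), of x] that(2) elim by (simp add: field_simps)
      have "norm (E (- real n) t - E (real n) t) \<le> 2 * C / real n" if "t \<in> {a..b}" for t
        using norm_triangle_ineq4[of "E (- real n) t" "E (real n) t"]
          E_le[OF that, of "real n"] E_le[OF that, of "- real n"] by simp
      then have "norm (integral {a..b} (\<lambda>t. E (- real n) t - E (real n) t))
          \<le> integral {a..b} (\<lambda>t. 2 * C / real n)"
        using int_E by (intro integral_norm_bound_integral) auto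
      then show ?case
        using rectangle_balance[OF \<open>a \<le> b\<close> _ Dt Ex cont, of "- real n" "real n"] \<open>a \<le> b\<close>
        by (simp add: J_def mult_ac)
    qed
  qed
  ultimately have "(\<integral>x. D x b - D x a \<partial>lborel) = 0"
    by (rule LIMSEQ_unique)
  then show ?thesis using int by simp
qed

section \<open>A regularised conservation law for the complex Burgers equation\<close>

text \<open>The variable \<open>y = v / (x + \<i>L - t v)\<close>, a fractional linear function of the value \<open>v\<close> of
  the solution at \<open>(x, t)\<close>.\<close>

definition fractional_image :: "real \<Rightarrow> real \<Rightarrow> real \<Rightarrow> complex \<Rightarrow> complex" where
  "fractional_image L x t v = v / (of_real x + of_real L * \<i> - of_real t * v)"

text \<open>The conserved density
  \<open>\<integral> k s^(k - 1) (\<i>L / (x - t s + \<i>L))^(k + 2) ds\<close> over \<open>s\<close> from \<open>0\<close> to \<open>v\<close> and the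
  corresponding flux, with \<open>k s^k\<close> in place of \<open>k s^(k - 1)\<close>, both in closed form (the density for
  \<open>k > 0\<close>). The substitution \<open>s / (x + \<i>L - t s)\<close> turns the integrands into polynomials; with
  the exponent \<open>k + 1\<close> in place of \<open>k + 2\<close> the flux would contain a logarithm.\<close>

definition reg_density :: "nat \<Rightarrow> real \<Rightarrow> real \<Rightarrow> real \<Rightarrow> complex \<Rightarrow> complex" where
  "reg_density k L x t v = (of_real L * \<i>) ^ (k + 2) / (of_real x + of_real L * \<i>)\<^sup>2 *
     (fractional_image L x t v ^ k
       + of_nat k / of_nat (Suc k) * of_real t * fractional_image L x t v ^ Suc k)"

definition reg_flux :: "nat \<Rightarrow> real \<Rightarrow> real \<Rightarrow> real \<Rightarrow> complex \<Rightarrow> complex" where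
  "reg_flux k L x t v = (of_real L * \<i>) ^ (k + 2) * of_nat k / of_nat (Suc k) *
     (fractional_image L x t v ^ Suc k / (of_real x + of_real L * \<i>))"

lemma has_vector_derivative_power:
  fixes g :: "real \<Rightarrow> 'a :: real_normed_field"
  assumes "(g has_vector_derivative g') (at x)"
  shows "((\<lambda>x. g x ^ n) has_vector_derivative (of_nat n * g x ^ (n - 1) * g')) (at x)"
proof -
  have "((\<lambda>z. z ^ n) has_field_derivative of_nat n * g x ^ (n - 1)) (at (g x))"
    by (auto intro!: derivative_eq_intros)
  from field_vector_diff_chain_at[OF assms this] show ?thesis
    by (simp add: o_def mult_ac)
qed

lemma has_vector_derivative_quotient:
  fixes g h :: "real \<Rightarrow> 'a :: real_normed_field"
  assumes g: "(g has_vector_derivative g') (at x)" and h: "(h has_vector_derivative h') (at x)"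
    and nz: "h x \<noteq> 0"
  shows "((\<lambda>x. g x / h x) has_vector_derivative ((g' * h x - g x * h') / (h x)\<^sup>2)) (at x)"
proof -
  have "(inverse has_field_derivative - (inverse (h x))\<^sup>2) (at (h x))"
    using nz by (auto intro!: derivative_eq_intros simp: power2_eq_square)
  from field_vector_diff_chain_at[OF h this]
  have "((\<lambda>x. inverse (h x)) has_vector_derivative (h' * - (inverse (h x))\<^sup>2)) (at x)"
    by (simp add: o_def)
  from has_vector_derivative_mult[OF g this] show ?thesis
    using nz by (simp add: field_simps power2_eq_square)
qed

lemma tendsto_ratio_one:
  fixes d :: complex
  shows "((\<lambda>L. of_real L * \<i> / (d + of_real L * \<i>)) \<longlongrightarrow> 1) at_top"
    and "((\<lambda>L. 1 / (d + of_real L * \<i>)) \<longlongrightarrow> 0) at_top"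
proof -
  have "filterlim (\<lambda>L. of_real L * \<i> :: complex) at_infinity at_top"
    unfolding filterlim_at_infinity_conv_norm_at_top by (simp add: norm_mult filterlim_abs_real)
  then have inf: "filterlim (\<lambda>L. d + of_real L * \<i>) at_infinity at_top"
    by (rule tendsto_add_filterlim_at_infinity[OF tendsto_const])
  then show "((\<lambda>L. 1 / (d + of_real L * \<i>)) \<longlongrightarrow> 0) at_top"
    by (rule tendsto_divide_0[OF tendsto_const])
  have "((\<lambda>L. 1 - d / (d + of_real L * \<i>)) \<longlongrightarrow> 1 - 0) at_top"
    by (intro tendsto_intros tendsto_divide_0[OF tendsto_const] inf)
  moreover have "\<forall>\<^sub>F L in at_top. 1 - d / (d + of_real L * \<i>) = of_real L * \<i> / (d + of_real L * \<i>)"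
    using filterlim_at_infinity_imp_eventually_ne[OF inf, of 0]
    by eventually_elim (simp add: field_simps)
  ultimately show "((\<lambda>L. of_real L * \<i> / (d + of_real L * \<i>)) \<longlongrightarrow> 1) at_top"
    by (simp add: tendsto_cong)
qed

text \<open>In this form each factor has a limit as \<open>L \<rightarrow> \<infinity>\<close> and a bound uniform in \<open>L\<close>.\<close>

lemma reg_density_factored:
  "reg_density k L x t v = (of_real L * \<i> / (of_real x + of_real L * \<i>))\<^sup>2 *
     ((of_real L * \<i> * fractional_image L x t v) ^ k
       * (1 + of_nat k / of_nat (Suc k) * of_real t * fractional_image L x t v))"
proof -
  have "q ^ (k + 2) / z\<^sup>2 * (y ^ k + c * y ^ Suc k) = (q / z)\<^sup>2 * ((q * y) ^ k * (1 + c * y))"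
    for q z c y :: complex
  proof -
    have "y ^ k + c * y ^ Suc k = y ^ k * (1 + c * y)"
      by (simp add: distrib_left)
    then show ?thesis
      by (simp add: power_add power_mult_distrib power_divide power2_eq_square)
  qed
  then show ?thesis
    unfolding reg_density_def .
qed

lemma reg_density_tendsto: "((\<lambda>L. reg_density k L x t v) \<longlongrightarrow> v ^ k) at_top"
proof -
  have y: "fractional_image L x t v = v * (1 / ((of_real x - of_real t * v) + of_real L * \<i>))"
    "of_real L * \<i> * fractional_image L x t v = v * (of_real L * \<i> / ((of_real x - of_real t * v) + of_real L * \<i>))" for L
    by (simp_all add: fractional_image_def algebra_simps)
  have y0: "((\<lambda>L. fractional_image L x t v) \<longlongrightarrow> v * 0) at_top"
    unfolding y(1) by (intro tendsto_mult tendsto_const tendsto_ratio_one)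
  have y1: "((\<lambda>L. of_real L * \<i> * fractional_image L x t v) \<longlongrightarrow> v * 1) at_top"
    unfolding y(2) by (rule tendsto_mult[OF tendsto_const tendsto_ratio_one(1)])
  have "((\<lambda>L. reg_density k L x t v) \<longlongrightarrow>
      1\<^sup>2 * ((v * 1) ^ k * (1 + of_nat k / of_nat (Suc k) * of_real t * (v * 0)))) at_top"
    unfolding reg_density_factored
    by (rule tendsto_mult[OF tendsto_power[OF tendsto_ratio_one(1)] tendsto_mult[OF tendsto_power[OF y1]
          tendsto_add[OF tendsto_const tendsto_mult[OF tendsto_const y0]]]])
  then show ?thesis
    by (simp only: power_one mult_1_left mult_1_right mult_zero_right add_0_right)
qed

text \<open>A bounded classical solution of the complex Burgers equation \<open>w\<^sub>t + w w\<^sub>x = 0\<close> on the slab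
  \<open>a \<le> t \<le> b\<close>, with \<open>wx\<close> its derivative in \<open>x\<close>. The time derivative is two-sided at \<open>t = a\<close> and
  \<open>t = b\<close> as well: the solutions considered are defined for all \<open>t > 0\<close>.\<close>

locale complex_burgers_strip =
  fixes w wx :: "real \<Rightarrow> real \<Rightarrow> complex" and a b M :: real
  assumes a_pos: "0 < a" and ab: "a \<le> b"
    and w_x: "\<And>x t. t \<in> {a..b} \<Longrightarrow> ((\<lambda>y. w y t) has_vector_derivative wx x t) (at x)"
    and w_t: "\<And>x t. t \<in> {a..b} \<Longrightarrow> ((\<lambda>s. w x s) has_vector_derivative - (w x t * wx x t)) (at t)"
    and cont_w: "continuous_on (UNIV \<times> {a..b}) (\<lambda>(x, t). w x t)"
    and cont_wx: "continuous_on (UNIV \<times> {a..b}) (\<lambda>(x, t). wx x t)"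
    and w_bound: "\<And>x t. t \<in> {a..b} \<Longrightarrow> norm (w x t) \<le> M"
begin

lemma M_nonneg: "0 \<le> M"
  using order_trans[OF norm_ge_zero w_bound[of a]] ab by auto

text \<open>The lower bound \<open>2 b M\<close> on \<open>L\<close> keeps \<open>x + \<i>L - t w\<close> at distance at least \<open>L / 2\<close> from
  zero.\<close>

context
  fixes L :: real
  assumes L_ge: "1 \<le> L" "2 * b * M \<le> L"
begin

lemma shifted_nonzero: "of_real x + of_real L * \<i> \<noteq> (0 :: complex)"
  using L_ge by (auto simp: complex_eq_iff)

lemma denominator_ge:
  assumes "t \<in> {a..b}"
  shows "L / 2 \<le> norm (of_real x + of_real L * \<i> - of_real t * w x t)"
proof -
  have "t * Im (w x t) \<le> t * norm (w x t)"
    using assms a_pos by (intro mult_left_mono) (auto intro: order_trans[OF _ abs_Im_le_cmod])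
  also have "\<dots> \<le> b * M"
    using assms a_pos w_bound[OF assms] by (intro mult_mono) auto
  finally have "L / 2 \<le> Im (of_real x + of_real L * \<i> - of_real t * w x t)"
    using L_ge by simp
  also have "\<dots> \<le> norm (of_real x + of_real L * \<i> - of_real t * w x t)"
    using abs_Im_le_cmod[of "of_real x + of_real L * \<i> - of_real t * w x t"] by linarith
  finally show ?thesis .
qed

lemma denominator_nonzero:
  assumes "t \<in> {a..b}"
  shows "of_real x + of_real L * \<i> - of_real t * w x t \<noteq> 0"
  using denominator_ge[OF assms, of x] L_ge by auto

lemma fractional_image_bound:
  assumes "t \<in> {a..b}"
  shows "L * norm (fractional_image L x t (w x t)) \<le> 2 * norm (w x t)"
proof -
  have "norm (w x t) * (L / 2) \<le> norm (w x t) * norm (of_real x + of_real L * \<i> - of_real t * w x t)"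
    by (intro mult_left_mono denominator_ge[OF assms]) auto
  moreover have "norm (of_real x + of_real L * \<i> - of_real t * w x t) > 0"
    using denominator_nonzero[OF assms] by simp
  ultimately show ?thesis
    unfolding fractional_image_def norm_divide by (simp add: field_simps)
qed

text \<open>The derivatives \<open>y\<^sub>x\<close> and \<open>D\<^sub>t = - E\<^sub>x\<close> are written without the time derivative of \<open>w\<close>, so that
  their continuity follows from that of \<open>w\<close> and \<open>wx\<close>.\<close>

abbreviation (input) y where "y x t \<equiv> fractional_image L x t (w x t)"

definition fractional_image_dx where
  "fractional_image_dx x t = ((of_real x + of_real L * \<i>) * wx x t - w x t) / (of_real x + of_real L * \<i> - of_real t * w x t)\<^sup>2"

definition reg_density_dt where
  "reg_density_dt k x t = (of_real L * \<i>) ^ (k + 2) * of_nat k / of_nat (Suc k) *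
     (y x t ^ Suc k / (of_real x + of_real L * \<i>)\<^sup>2
       - of_nat (Suc k) * y x t ^ k * fractional_image_dx x t / (of_real x + of_real L * \<i>))"

lemma fractional_image_x:
  assumes "t \<in> {a..b}"
  shows "((\<lambda>x. y x t) has_vector_derivative fractional_image_dx x t) (at x)"
proof -
  have "((\<lambda>x. of_real x + of_real L * \<i> - of_real t * w x t) has_vector_derivative
      1 - of_real t * wx x t) (at x)"
    by (auto intro!: derivative_eq_intros w_x assms has_vector_derivative_of_real)
  from has_vector_derivative_quotient[OF w_x[OF assms] this denominator_nonzero[OF assms]]
  show ?thesis
    unfolding fractional_image_def fractional_image_dx_def by (simp add: algebra_simps)
qed

text \<open>Since \<open>y\<close> is a function of \<open>w\<close> and \<open>x - t w\<close> alone, it satisfies \<open>y\<^sub>t = - w y\<^sub>x\<close> like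
  these two.\<close>

lemma fractional_image_t:
  assumes "t \<in> {a..b}"
  shows "((\<lambda>s. y x s) has_vector_derivative - w x t * fractional_image_dx x t) (at t)"
proof -
  have "((\<lambda>s. of_real x + of_real L * \<i> - of_real s * w x s) has_vector_derivative
      - w x t - of_real t * - (w x t * wx x t)) (at t)"
    by (auto intro!: derivative_eq_intros w_t assms has_vector_derivative_of_real)
  from has_vector_derivative_quotient[OF w_t[OF assms, of x] this denominator_nonzero[OF assms]]
  show ?thesis
    unfolding fractional_image_def fractional_image_dx_def by (simp add: algebra_simps)
qed

lemma reg_flux_x:
  assumes "t \<in> {a..b}"
  shows "((\<lambda>x. reg_flux k L x t (w x t)) has_vector_derivative - reg_density_dt k x t) (at x)"
proof -
  have "((\<lambda>x. of_real x + of_real L * \<i>) has_vector_derivative (1 :: complex)) (at x)"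
    by (auto intro!: derivative_eq_intros has_vector_derivative_of_real)
  from has_vector_derivative_quotient[OF has_vector_derivative_power[OF fractional_image_x[OF assms], of "Suc k"]
      this shifted_nonzero]
  have "((\<lambda>x. y x t ^ Suc k / (of_real x + of_real L * \<i>)) has_vector_derivative
    of_nat (Suc k) * y x t ^ k * fractional_image_dx x t / (of_real x + of_real L * \<i>)
     - y x t ^ Suc k / (of_real x + of_real L * \<i>)\<^sup>2) (at x)"
    using shifted_nonzero[of x] by (simp add: diff_divide_distrib power2_eq_square)
  from has_vector_derivative_mult_right[OF this, of "(of_real L * \<i>) ^ (k + 2) * of_nat k / of_nat (Suc k)"]
  show ?thesis
    unfolding reg_flux_def reg_density_dt_def by (simp only: right_diff_distrib minus_diff_eq)
qed

lemma reg_density_t: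
  assumes "t \<in> {a..b}" "0 < k"
  shows "((\<lambda>s. reg_density k L x s (w x s)) has_vector_derivative reg_density_dt k x t) (at t)"
proof -
  define z :: complex where "z = of_real x + of_real L * \<i>"
  define d where "d = z - of_real t * w x t"
  obtain n where k: "k = Suc n" using \<open>0 < k\<close> by (cases k) auto
  note yt = fractional_image_t[OF assms(1), of x]
  have "z \<noteq> 0" "d \<noteq> 0"
    using shifted_nonzero denominator_nonzero[OF assms(1)] by (auto simp: z_def d_def)
  have "y x t = w x t / d"
    by (simp add: fractional_image_def z_def d_def)
  \<comment> \<open>the inverse fractional linear map \<open>w = z y / (1 + t y)\<close>; it makes the terms with
    \<open>y\<^sub>x\<close> in \<open>D\<^sub>t\<close> and \<open>E\<^sub>x\<close> cancel\<close>
  with \<open>d \<noteq> 0\<close> have wy: "(1 + of_real t * y x t) * w x t = z * y x t"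
    by (simp add: field_simps d_def)
  have "((\<lambda>s. y x s ^ k + of_nat k / of_nat (Suc k) * of_real s * y x s ^ Suc k) has_vector_derivative
     of_nat k * y x t ^ (k - 1) * (- w x t * fractional_image_dx x t)
     + of_nat k / of_nat (Suc k) * (of_real t * (of_nat (Suc k) * y x t ^ k * (- w x t * fractional_image_dx x t)) + y x t ^ Suc k)) (at t)"
    using has_vector_derivative_add[OF has_vector_derivative_power[OF yt, of k]
       has_vector_derivative_mult_right[OF has_vector_derivative_mult[OF has_vector_derivative_of_real[OF DERIV_ident]
         has_vector_derivative_power[OF yt, of "Suc k"]], of "of_nat k / of_nat (Suc k)"]]
    by (simp add: mult.assoc)
  also have "of_nat k * y x t ^ (k - 1) * (- w x t * fractional_image_dx x t)
     + of_nat k / of_nat (Suc k) * (of_real t * (of_nat (Suc k) * y x t ^ k * (- w x t * fractional_image_dx x t)) + y x t ^ Suc k)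
    = of_nat k / of_nat (Suc k) * y x t ^ Suc k
      - of_nat k * y x t ^ n * fractional_image_dx x t * ((1 + of_real t * y x t) * w x t)"
    by (simp add: k field_simps del: of_nat_Suc)
  also have "\<dots> = of_nat k / of_nat (Suc k) * (y x t ^ Suc k - of_nat (Suc k) * y x t ^ k * fractional_image_dx x t * z)"
    unfolding wy by (simp add: k field_simps del: of_nat_Suc)
  finally have "((\<lambda>s. y x s ^ k + of_nat k / of_nat (Suc k) * of_real s * y x s ^ Suc k) has_vector_derivative
     of_nat k / of_nat (Suc k) * (y x t ^ Suc k - of_nat (Suc k) * y x t ^ k * fractional_image_dx x t * z)) (at t)" .
  from has_vector_derivative_mult_right[OF this, of "(of_real L * \<i>) ^ (k + 2) / z\<^sup>2"]
  show ?thesis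
    unfolding reg_density_def reg_density_dt_def z_def[symmetric]
    by (rule has_vector_derivative_eq_rhs)
      (use \<open>z \<noteq> 0\<close> in \<open>simp add: power2_eq_square right_diff_distrib mult_ac del: of_nat_Suc\<close>)
qed

lemma continuous_on_reg_density_dt: "continuous_on (UNIV \<times> {a..b}) (\<lambda>(x, t). reg_density_dt k x t)"
proof -
  let ?S = "(UNIV :: real set) \<times> {a..b}"
  have w: "continuous_on ?S (\<lambda>p. w (fst p) (snd p))"
    and wx: "continuous_on ?S (\<lambda>p. wx (fst p) (snd p))"
    using cont_w cont_wx by (simp_all add: case_prod_beta)
  have z: "continuous_on ?S (\<lambda>p. of_real (fst p) + of_real L * \<i> :: complex)"
    by (intro continuous_intros)
  have d: "continuous_on ?S (\<lambda>p. of_real (fst p) + of_real L * \<i> - of_real (snd p) * w (fst p) (snd p))"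
    by (intro continuous_intros w)
  have z_nz: "\<forall>p\<in>?S. of_real (fst p) + of_real L * \<i> \<noteq> (0 :: complex)"
    using shifted_nonzero by blast
  have d_nz: "of_real (fst p) + of_real L * \<i> - of_real (snd p) * w (fst p) (snd p) \<noteq> 0" if "p \<in> ?S" for p
    using denominator_nonzero[of "snd p" "fst p"] that by (simp add: mem_Times_iff)
  have y: "continuous_on ?S (\<lambda>p. y (fst p) (snd p))"
    unfolding fractional_image_def by (rule continuous_on_divide[OF w d]) (use d_nz in blast)
  have "continuous_on ?S (\<lambda>p. fractional_image_dx (fst p) (snd p))"
    unfolding fractional_image_dx_def
    by (rule continuous_on_divide[OF continuous_on_diff[OF continuous_on_mult[OF z wx] w] continuous_on_power[OF d]])
      (use d_nz in simp)
  then show ?thesis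
    unfolding reg_density_dt_def case_prod_beta
    by (intro continuous_on_mult continuous_on_diff continuous_on_divide continuous_on_power
          continuous_on_const y z) (use z_nz in simp_all)
qed

lemma reg_density_bound:
  assumes t: "t \<in> {a..b}"
  shows "norm (reg_density k L x t (w x t)) \<le> 2 ^ Suc k * norm (w x t) ^ k"
proof -
  define z :: complex where "z = of_real x + of_real L * \<i>"
  have ratio: "norm ((of_real L * \<i> / z)\<^sup>2) \<le> 1"
  proof -
    have "L \<le> norm z"
      using abs_Im_le_cmod[of z] by (simp add: z_def)
    then show ?thesis
      using L_ge by (auto simp: norm_divide norm_mult norm_power divide_le_eq_1 intro!: power_le_one)
  qed
  have Ly: "norm (of_real L * \<i> * y x t) \<le> 2 * norm (w x t)"
    using fractional_image_bound[OF t, of x] L_ge by (simp add: norm_mult)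
  have ty: "t * norm (y x t) \<le> 1"
  proof -
    have "L * (t * norm (y x t)) \<le> t * (2 * norm (w x t))"
      using mult_left_mono[OF fractional_image_bound[OF t, of x], of t] t a_pos by (simp add: mult_ac)
    also have "\<dots> \<le> b * (2 * M)"
      using t a_pos w_bound[OF t] by (intro mult_mono) auto
    also have "\<dots> \<le> L" using L_ge by simp
    finally show ?thesis using L_ge by simp
  qed
  have "norm (1 + of_nat k / of_nat (Suc k) * of_real t * y x t) \<le> 1 + real k / real (Suc k) * (t * norm (y x t))"
    using t a_pos by (intro norm_triangle_le) (simp add: norm_mult norm_divide del: of_nat_Suc)
  also have "\<dots> \<le> 1 + 1 * 1"
    using ty t a_pos by (intro add_mono mult_mono) auto
  finally have two: "norm (1 + of_nat k / of_nat (Suc k) * of_real t * y x t) \<le> 2" by simp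
  have "norm (reg_density k L x t (w x t)) \<le> 1 * ((2 * norm (w x t)) ^ k * 2)"
    unfolding reg_density_factored z_def[symmetric] norm_mult[of "_\<^sup>2"] norm_mult[of "_ ^ k"] norm_power[of _ k]
    using ratio Ly two by (intro mult_mono power_mono) auto
  then show ?thesis by (simp add: power_mult_distrib mult_ac)
qed

lemma reg_flux_decay:
  assumes t: "t \<in> {a..b}"
  shows "\<bar>x\<bar> * norm (reg_flux k L x t (w x t)) \<le> L ^ (k + 2) * (2 * M) ^ Suc k"
proof -
  define z :: complex where "z = of_real x + of_real L * \<i>"
  have z: "z \<noteq> 0" using shifted_nonzero by (simp add: z_def)
  have "\<bar>x\<bar> \<le> norm z"
    using abs_Re_le_cmod[of z] by (simp add: z_def)
  then have xz: "\<bar>x\<bar> / norm z \<le> 1"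
    using z by (simp add: divide_le_eq_1)
  have "norm (y x t) \<le> L * norm (y x t)"
    using L_ge by (simp add: mult_le_cancel_right1)
  then have ym: "norm (y x t) \<le> 2 * M"
    using fractional_image_bound[OF t, of x] w_bound[OF t, of x] by linarith
  have "\<bar>x\<bar> * norm (reg_flux k L x t (w x t))
     = L ^ (k + 2) * norm (y x t) ^ Suc k * (real k / real (Suc k)) * (\<bar>x\<bar> / norm z)"
    unfolding reg_flux_def z_def[symmetric]
    using L_ge by (simp add: norm_mult norm_divide norm_power del: of_nat_Suc)
  also have "\<dots> \<le> L ^ (k + 2) * (2 * M) ^ Suc k * 1 * 1"
    using xz ym L_ge M_nonneg by (intro mult_mono power_mono mult_nonneg_nonneg) auto
  finally show ?thesis by simp
qed

end

lemma power_integral_conserved: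
  assumes "0 < k"
    and int: "integrable lborel (\<lambda>x. w x a ^ k)" "integrable lborel (\<lambda>x. w x b ^ k)"
  shows "(\<integral>x. w x b ^ k \<partial>lborel) = (\<integral>x. w x a ^ k \<partial>lborel)"
proof -
  \<comment> \<open>any sequence tending to infinity that is admissible from the first term on\<close>
  define L where "L n = real n + (1 + 2 * b * M)" for n
  have L: "1 \<le> L n" "2 * b * M \<le> L n" for n
    using a_pos ab M_nonneg by (auto simp: L_def)
  have w_meas: "(\<lambda>x. w x t) \<in> borel_measurable borel" if "t \<in> {a..b}" for t
    using has_vector_derivative_continuous[OF w_x[OF that]]
    by (intro borel_measurable_continuous_onI) (simp add: continuous_on_eq_continuous_at)
  have meas: "(\<lambda>x. reg_density k (L n) x t (w x t)) \<in> borel_measurable lborel" if "t \<in> {a..b}" for n t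
    using w_meas[OF that] unfolding reg_density_def fractional_image_def by measurable
  have bound: "norm (reg_density k (L n) x t (w x t)) \<le> 2 ^ Suc k * norm (w x t ^ k)"
    if "t \<in> {a..b}" for n x t
    using reg_density_bound[OF L that] by (simp add: norm_power)
  have reg_int: "integrable lborel (\<lambda>x. reg_density k (L n) x t (w x t))"
    if "t \<in> {a..b}" "integrable lborel (\<lambda>x. w x t ^ k)" for n t
    by (rule Bochner_Integration.integrable_bound[where f = "\<lambda>x. 2 ^ Suc k * norm (w x t ^ k)"])
       (use that meas bound in auto)
  have lim: "(\<lambda>n. \<integral>x. reg_density k (L n) x t (w x t) \<partial>lborel) \<longlonglongrightarrow> (\<integral>x. w x t ^ k \<partial>lborel)"
    if "t \<in> {a..b}" "integrable lborel (\<lambda>x. w x t ^ k)" for t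
  proof (rule integral_dominated_convergence[where w = "\<lambda>x. 2 ^ Suc k * norm (w x t ^ k)"])
    have "filterlim L at_top sequentially"
      unfolding L_def
      by (rule filterlim_at_top_mono[OF filterlim_real_sequentially])
        (use a_pos ab M_nonneg in auto)
    then show "AE x in lborel. (\<lambda>n. reg_density k (L n) x t (w x t)) \<longlonglongrightarrow> w x t ^ k"
      by (intro AE_I2 filterlim_compose[OF reg_density_tendsto])
  qed (use that meas bound w_meas in auto)
  have "(\<integral>x. reg_density k (L n) x b (w x b) \<partial>lborel) = (\<integral>x. reg_density k (L n) x a (w x a) \<partial>lborel)" for n
    by (rule line_balance[OF ab reg_density_t[OF L _ \<open>0 < k\<close>] reg_flux_x[OF L] continuous_on_reg_density_dt[OF L]
          reg_flux_decay[OF L] reg_int reg_int])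
       (use ab int in auto)
  then show ?thesis
    using lim[of a] lim[of b] ab int by (auto intro: LIMSEQ_unique)
qed

end

section \<open>Riemann invariants of the coupled system\<close>

lemma C1_half_planeD:
  assumes "C1_half_plane f" "0 < t"
  shows "((\<lambda>y. f y t) has_field_derivative dx f x t) (at x)"
    and "((\<lambda>s. f x s) has_field_derivative dt f x t) (at t)"
  using assms unfolding C1_half_plane_def dx_def dt_def
  by (auto simp: DERIV_deriv_iff_field_differentiable)

text \<open>Either complex root \<open>c\<close> of \<open>c\<^sup>2 = \<alpha>\<close> is allowed, which covers \<open>u + \<surd>\<alpha> \<rho>\<close> and \<open>u - \<surd>\<alpha> \<rho>\<close>
  alike.\<close>

lemma complex_burgers_strip_if_classical_solution:
  assumes sol: "classical_solution \<alpha> \<rho> u"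
    and bd: "bounded ((\<lambda>(x, t). \<rho> x t) ` (UNIV \<times> {a..b}))" "bounded ((\<lambda>(x, t). u x t) ` (UNIV \<times> {a..b}))"
    and ab: "0 < a" "a \<le> b"
    and c: "c\<^sup>2 = complex_of_real \<alpha>"
  shows "\<exists>M. complex_burgers_strip (\<lambda>x t. of_real (u x t) + c * of_real (\<rho> x t))
    (\<lambda>x t. of_real (dx u x t) + c * of_real (dx \<rho> x t)) a b M"
proof -
  have C1: "C1_half_plane \<rho>" "C1_half_plane u"
    using sol by (auto simp: classical_solution_def)
  note \<rho>_D = C1_half_planeD[OF C1(1)] and u_D = C1_half_planeD[OF C1(2)]
  have pde: "complex_of_real (dt u x t) + c * of_real (dt \<rho> x t)
    = - ((of_real (u x t) + c * of_real (\<rho> x t)) * (of_real (dx u x t) + c * of_real (dx \<rho> x t)))"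
    if "0 < t" for x t
  proof -
    have eqs: "dt \<rho> x t + dx (\<lambda>y s. \<rho> y s * u y s) x t = 0"
      "dt u x t + dx (\<lambda>y s. ((u y s)\<^sup>2 + \<alpha> * (\<rho> y s)\<^sup>2) / 2) x t = 0"
      using sol that by (auto simp: classical_solution_def)
    have "dx (\<lambda>y s. \<rho> y s * u y s) x t = dx \<rho> x t * u x t + \<rho> x t * dx u x t"
      unfolding dx_def[of "\<lambda>y s. \<rho> y s * u y s"] using \<rho>_D(1)[OF that] u_D(1)[OF that]
      by (intro DERIV_imp_deriv) (auto intro!: derivative_eq_intros)
    then have 1: "dt \<rho> x t = - (dx \<rho> x t * u x t + \<rho> x t * dx u x t)"
      using eqs(1) by linarith
    have "dx (\<lambda>y s. ((u y s)\<^sup>2 + \<alpha> * (\<rho> y s)\<^sup>2) / 2) x t = u x t * dx u x t + \<alpha> * \<rho> x t * dx \<rho> x t"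
      unfolding dx_def[of "\<lambda>y s. ((u y s)\<^sup>2 + \<alpha> * (\<rho> y s)\<^sup>2) / 2"] using \<rho>_D(1)[OF that] u_D(1)[OF that]
      by (intro DERIV_imp_deriv) (auto intro!: derivative_eq_intros)
    then have 2: "dt u x t = - (u x t * dx u x t + \<alpha> * \<rho> x t * dx \<rho> x t)"
      using eqs(2) by linarith
    show ?thesis
      unfolding 1 2 by (simp add: c[symmetric] algebra_simps power2_eq_square)
  qed
  obtain A where A: "\<And>x t. t \<in> {a..b} \<Longrightarrow> \<bar>\<rho> x t\<bar> \<le> A"
    using bd(1) by (fastforce simp: bounded_iff)
  obtain B where B: "\<And>x t. t \<in> {a..b} \<Longrightarrow> \<bar>u x t\<bar> \<le> B"
    using bd(2) by (fastforce simp: bounded_iff)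
  have cont: "continuous_on (UNIV \<times> {a..b}) (\<lambda>p. f (fst p) (snd p))"
      "continuous_on (UNIV \<times> {a..b}) (\<lambda>p. dx f (fst p) (snd p))" if "C1_half_plane f" for f
    using that ab unfolding C1_half_plane_def case_prod_beta
    by (auto elim!: continuous_on_subset)
  have "complex_burgers_strip (\<lambda>x t. of_real (u x t) + c * of_real (\<rho> x t))
    (\<lambda>x t. of_real (dx u x t) + c * of_real (dx \<rho> x t)) a b (B + norm c * A)"
  proof
    fix x t assume t: "t \<in> {a..b}"
    then have "0 < t" using ab by simp
    show "((\<lambda>y. of_real (u y t) + c * of_real (\<rho> y t)) has_vector_derivative
        of_real (dx u x t) + c * of_real (dx \<rho> x t)) (at x)"
      by (intro derivative_intros \<rho>_D u_D \<open>0 < t\<close>)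
    show "((\<lambda>s. of_real (u x s) + c * of_real (\<rho> x s)) has_vector_derivative
        - ((of_real (u x t) + c * of_real (\<rho> x t)) * (of_real (dx u x t) + c * of_real (dx \<rho> x t)))) (at t)"
      unfolding pde[OF \<open>0 < t\<close>, symmetric]
      by (intro derivative_intros \<rho>_D u_D \<open>0 < t\<close>)
    show "norm (of_real (u x t) + c * of_real (\<rho> x t)) \<le> B + norm c * A"
      using A[OF t] B[OF t] by (intro norm_triangle_mono) (auto simp: norm_mult intro: mult_left_mono)
  qed (use ab cont[OF C1(1)] cont[OF C1(2)] in \<open>auto simp: case_prod_beta intro!: continuous_intros\<close>)
  then show ?thesis ..
qed

lemma riemann_invariant_power_integral_const:
  assumes "classical_solution \<alpha> \<rho> u"
    and "\<And>a b. 0 < a \<Longrightarrow> a \<le> b \<Longrightarrow> bounded ((\<lambda>(x, t). \<rho> x t) ` (UNIV \<times> {a..b}))"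
    and "\<And>a b. 0 < a \<Longrightarrow> a \<le> b \<Longrightarrow> bounded ((\<lambda>(x, t). u x t) ` (UNIV \<times> {a..b}))"
    and "c\<^sup>2 = complex_of_real \<alpha>" and "0 < k"
    and int: "\<And>t. 0 < t \<Longrightarrow> integrable lborel (\<lambda>x. (of_real (u x t) + c * of_real (\<rho> x t)) ^ k)"
  shows "(\<lambda>t. \<integral>x. (of_real (u x t) + c * of_real (\<rho> x t)) ^ k \<partial>lborel) constant_on {0<..}"
proof -
  define I where "I t = (\<integral>x. (of_real (u x t) + c * of_real (\<rho> x t)) ^ k \<partial>lborel)" for t
  have eq: "I b = I a" if ab: "0 < a" "a \<le> b" for a b
  proof -
    from complex_burgers_strip_if_classical_solution
        [OF assms(1) assms(2)[OF ab] assms(3)[OF ab] ab assms(4)]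
    obtain M where M: "complex_burgers_strip (\<lambda>x t. of_real (u x t) + c * of_real (\<rho> x t))
        (\<lambda>x t. of_real (dx u x t) + c * of_real (dx \<rho> x t)) a b M"
      by (rule exE)
    have "0 < b" using ab by linarith
    show ?thesis
      unfolding I_def
      by (rule complex_burgers_strip.power_integral_conserved
          [OF M \<open>0 < k\<close> int[OF \<open>0 < a\<close>] int[OF \<open>0 < b\<close>]])
  qed
  have "I t = I 1" if "0 < t" for t
  proof (cases "t \<le> 1")
    case True
    show ?thesis by (rule eq[OF that True, symmetric])
  next
    case False
    show ?thesis by (rule eq) (use False in linarith)+
  qed
  then have "I constant_on {0<..}"
    unfolding constant_on_def by blast
  then show ?thesis
    unfolding I_def .
qed

theorem proposition3p1:
  fixes \<alpha> :: real
    and \<rho> u :: "real \<Rightarrow> real \<Rightarrow> real"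
    and lam1 lam2 :: complex
    and k1 k2 :: nat
  assumes "classical_solution \<alpha> \<rho> u"
    and "\<And>a b. 0 < a \<Longrightarrow> a \<le> b \<Longrightarrow> bounded ((\<lambda>(x, t). \<rho> x t) ` (UNIV \<times> {a..b}))"
    and "\<And>a b. 0 < a \<Longrightarrow> a \<le> b \<Longrightarrow> bounded ((\<lambda>(x, t). u x t) ` (UNIV \<times> {a..b}))"
    and "k1 > 0" and "k2 > 0"
    and "\<And>t. t > 0 \<Longrightarrow> lam1 \<noteq> 0 \<Longrightarrow> integrable lborel (\<lambda>x. w_plus \<alpha> \<rho> u x t ^ k1)"
    and "\<And>t. t > 0 \<Longrightarrow> lam2 \<noteq> 0 \<Longrightarrow> integrable lborel (\<lambda>x. w_minus \<alpha> \<rho> u x t ^ k2)"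
  shows "(\<lambda>t. lam1 * (\<integral>x. w_plus \<alpha> \<rho> u x t ^ k1 \<partial>lborel)
             + lam2 * (\<integral>x. w_minus \<alpha> \<rho> u x t ^ k2 \<partial>lborel)) constant_on {0<..}"
proof -
  have minus: "w_minus \<alpha> \<rho> u x t = of_real (u x t) + (- csqrt (of_real \<alpha>)) * of_real (\<rho> x t)" for x t
    by (simp add: w_minus_def)
  have "(\<lambda>t. lam1 * (\<integral>x. w_plus \<alpha> \<rho> u x t ^ k1 \<partial>lborel)) constant_on {0<..}"
  proof (cases "lam1 = 0")
    case False
    then have "(\<lambda>t. \<integral>x. w_plus \<alpha> \<rho> u x t ^ k1 \<partial>lborel) constant_on {0<..}"
      using assms unfolding w_plus_def
      by (intro riemann_invariant_power_integral_const[of \<alpha>]) auto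
    then show ?thesis by (force simp: constant_on_def)
  qed (simp add: constant_on_def)
  moreover have "(\<lambda>t. lam2 * (\<integral>x. w_minus \<alpha> \<rho> u x t ^ k2 \<partial>lborel)) constant_on {0<..}"
  proof (cases "lam2 = 0")
    case False
    then have "(\<lambda>t. \<integral>x. w_minus \<alpha> \<rho> u x t ^ k2 \<partial>lborel) constant_on {0<..}"
      using assms unfolding minus
      by (intro riemann_invariant_power_integral_const[of \<alpha>]) auto
    then show ?thesis by (force simp: constant_on_def)
  qed (simp add: constant_on_def)
  ultimately show ?thesis
    unfolding constant_on_def by metis
qed

end
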